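(* Let $q$ be a prime power, let $k \ge 3$ and $s$ be integers with $0 < s < q-2$ and $(s+2) \mid q$, and let $\mathcal{K}$ be an $(n, k+s-1)$-arc in $\mathrm{PG}(k-1,q)$ with $n = (s+1)(q+1)+k-3$. Then there exists a unique point $X \in \mathrm{PG}(k-1,q)$ that is incident with all tangents to $\mathcal{K}$ and not incident with any secant of $\mathcal{K}$. Consequently, $\mathcal{K}$ is not complete and admits a unique extension to a maximal $(n+1, k+s-1)$-arc (that is, there is exactly one point $X\notin\mathcal{K}$ such that $\mathcal{K}\cup\{X\}$ is an $(n+1,k+s-1)$-arc, and this arc is maximal).
   Context: $\mathrm{PG}(k-1,q)$ is the projective space of dimension $k-1$ over $\mathbb{F}_q$; hyperplanes are its projective subspaces of codimension 1. For $r \ge k-1$, an $(n,r)$-arc in $\mathrm{PG}(k-1,q)$ is a set $\mathcal{K}$ of $n > r$ points such that every hyperplane meets $\mathcal{K}$ in at most $r$ points and at least one hyperplane meets $\mathcal{K}$ in exactly $r$ points. An $(n,r)$-arc is complete if it is not contained in an $(n+1,r)$-arc of $\mathrm{PG}(k-1,q)$. Relative to an $(n,k-1+s)$-arc $\mathcal{K}$, a hyperplane is called a secant if it contains exactly $k-1+s$ points of $\mathcal{K}$, a tangent if it contains a positive number of points of $\mathcal{K}$ fewer than $k-1+s$, and external if it contains no point of $\mathcal{K}$. An $(n,k+s-1)$-arc in $\mathrm{PG}(k-1,q)$ always satisfies $n \le (s+1)(q+1)+k-2$, and it is called maximal if equality holds. *)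

theory Defs
  imports "HOL-Analysis.Cartesian_Space"
begin

text \<open>
  The projective space \<open>PG(k - 1, q)\<close> is modelled on the vector space \<open>'a ^ 'n\<close>, where
  \<open>'a\<close> is a field with \<open>q\<close> elements and \<open>CARD('n) = k\<close>. A projective subspace is
  identified with the linear subspace it comes from, so that incidence is inclusion and the
  linear dimension exceeds the projective dimension by one.
\<close>

definition pg_points :: "('a::field ^ 'n) set set" where
  "pg_points = {P. vec.subspace P \<and> vec.dim P = 1}"

definition pg_hyperplanes :: "('a::field ^ 'n) set set" where
  "pg_hyperplanes = {H. vec.subspace H \<and> vec.dim H = CARD('n) - 1}"

definition points_on :: "('a::field ^ 'n) set set \<Rightarrow> ('a ^ 'n) set \<Rightarrow> ('a ^ 'n) set set" where
  "points_on K H = {P \<in> K. P \<subseteq> H}"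

definition arc :: "nat \<Rightarrow> nat \<Rightarrow> ('a::{field,finite} ^ 'n) set set \<Rightarrow> bool" where
  "arc n r K \<longleftrightarrow>
     CARD('n) - 1 \<le> r \<and> r < n \<and> K \<subseteq> pg_points \<and> card K = n \<and>
     (\<forall>H\<in>pg_hyperplanes. card (points_on K H) \<le> r) \<and>
     (\<exists>H\<in>pg_hyperplanes. card (points_on K H) = r)"

definition complete_arc :: "nat \<Rightarrow> nat \<Rightarrow> ('a::{field,finite} ^ 'n) set set \<Rightarrow> bool" where
  "complete_arc n r K \<longleftrightarrow> arc n r K \<and> \<not> (\<exists>K'. arc (n + 1) r K' \<and> K \<subseteq> K')"

text \<open>
  In the next two definitions \<open>r\<close> is the parameter of the \<open>(n, r)\<close>-arc \<open>K\<close>, that is,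
  \<open>r = k - 1 + s\<close>.
\<close>

definition secant :: "nat \<Rightarrow> ('a::{field,finite} ^ 'n) set set \<Rightarrow> ('a ^ 'n) set \<Rightarrow> bool" where
  "secant r K H \<longleftrightarrow> H \<in> pg_hyperplanes \<and> card (points_on K H) = r"

definition tangent :: "nat \<Rightarrow> ('a::{field,finite} ^ 'n) set set \<Rightarrow> ('a ^ 'n) set \<Rightarrow> bool" where
  "tangent r K H \<longleftrightarrow>
     H \<in> pg_hyperplanes \<and> 0 < card (points_on K H) \<and> card (points_on K H) < r"

text \<open>
  An \<open>(n, k + s - 1)\<close>-arc is maximal if it attains the bound \<open>n \<le> (s + 1) (q + 1) + k - 2\<close>.
  The natural-number subtractions here do not truncate, since \<open>k \<ge> 1\<close> and \<open>q \<ge> 2\<close>.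
\<close>

definition maximal_arc :: "nat \<Rightarrow> nat \<Rightarrow> ('a::{field,finite} ^ 'n) set set \<Rightarrow> bool" where
  "maximal_arc n s K \<longleftrightarrow>
     arc n (CARD('n) + s - 1) K \<and> n = (s + 1) * (CARD('a) + 1) + CARD('n) - 2"

end

theory Submission
  imports Defs
begin

text \<open>
  Write \<open>d = s + 2\<close>. Counting on the hyperplanes through a subspace of codimension 2 shows that any
  \<open>k - 1\<close> points of the arc are independent and that a hyperplane with at least \<open>k - 2\<close> points has
  \<open>r\<close> or \<open>r - 1\<close> of them.

  For \<open>k \<ge> 4\<close> no such arc exists. Let \<open>u\<close> be the number of further points on a hyperplane through
  \<open>k - 4\<close> points of the arc. Then \<open>u \<in> {0, 1, d, d + 1}\<close>, so
  \<open>(u - 1) (u - d) (u - d - 1) \<le> 0\<close>, whereas the sum of these values, computed from the first three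
  binomial moments of \<open>u\<close>, is positive.

  For \<open>k = 3\<close> the tangents are \<open>q + 1\<close> lines. Since \<open>d\<close> divides \<open>q\<close>, a count modulo \<open>d\<close> shows that
  every point lies on a tangent, and \<open>q + 1\<close> lines that cover the plane form a pencil, whose centre
  is the required point.

  Hyperplanes are represented by nonzero functionals and points by spanning vectors, so each
  hyperplane is counted \<open>q - 1\<close> times.
\<close>

subsection \<open>Functionals vanishing on a set of vectors\<close>

definition dot :: "'a::field ^ 'n \<Rightarrow> 'a ^ 'n \<Rightarrow> 'a" where
  "dot c x = (\<Sum>i\<in>UNIV. c $ i * x $ i)"

text \<open>As \<open>dot\<close> is symmetric, this one set plays two roles: the functionals that
  kill \<open>B\<close>, and, for \<open>B = {c}\<close> with \<open>c\<close> nonzero, the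
  hyperplane with coefficient vector \<open>c\<close>.\<close>

definition annih :: "('a::field ^ 'n) set \<Rightarrow> ('a ^ 'n) set" where
  "annih B = {c. \<forall>v\<in>B. dot c v = 0}"

lemma dot_commute: "dot c x = dot x c"
  by (simp add: dot_def mult.commute)

lemma dot_linear [simp]:
  "dot 0 x = 0" "dot c 0 = 0"
  "dot (a + c) x = dot a x + dot c x" "dot c (x + y) = dot c x + dot c y"
  "dot (a - c) x = dot a x - dot c x" "dot c (x - y) = dot c x - dot c y"
  "dot (t *s c) x = t * dot c x" "dot c (t *s x) = t * dot c x"
  by (simp_all add: dot_def algebra_simps sum.distrib sum_subtractf sum_distrib_left)

lemma subspace_annih: "vec.subspace (annih B)"
  by (auto simp: vec.subspace_def annih_def)

lemma zero_in_annih [simp]: "0 \<in> annih B"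
  by (simp add: annih_def)

lemma annih_iff_singleton: "c \<in> annih {x} \<longleftrightarrow> dot c x = 0"
  by (simp add: annih_def)

lemma annih_Un: "annih (A \<union> B) = annih A \<inter> annih B"
  by (auto simp: annih_def)

lemma annih_span: "c \<in> annih B \<Longrightarrow> x \<in> vec.span B \<Longrightarrow> dot c x = 0"
  by (rule vec.span_induct[where P = "\<lambda>x. dot c x = 0"])
    (auto simp: annih_def vec.subspace_def)

text \<open>Extending a maximal independent \<open>B' \<subseteq> B\<close> by \<open>v\<close>,
  some linear map kills \<open>B'\<close> and sends \<open>v\<close> to a standard basis vector. The
  matching row of its matrix is the functional.\<close>

lemma annih_separates:
  fixes B :: "('a::field ^ 'n) set"
  assumes "v \<notin> vec.span B"
  obtains c where "c \<in> annih B" "dot c v = 1"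
proof -
  obtain B' where B': "B' \<subseteq> B" "vec.independent B'" "B \<subseteq> vec.span B'"
    by (rule vec.maximal_independent_subset)
  have "v \<notin> vec.span B'"
    using assms B'(1) vec.span_mono by blast
  then have ind: "vec.independent (insert v B')"
    using B'(2) by (rule vec.independent_insertI)
  obtain i :: 'n where True by simp
  obtain g where g: "Vector_Spaces.linear (*s) (*s) g"
      "\<forall>x\<in>insert v B'. g x = (if x = v then axis i 1 else (0 :: 'a ^ 'n))"
    using vec.linear_independent_extend[OF ind, of "\<lambda>x. if x = v then axis i 1 else 0"] by blast
  define c where "c = matrix g $ i"
  have c: "dot c x = g x $ i" for x
    using matrix_works[OF g(1), of x]
    by (simp add: c_def dot_def matrix_vector_mult_def vec_eq_iff)
  have "v \<notin> B'"
    using \<open>v \<notin> vec.span B'\<close> vec.span_base by blast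
  then have B'0: "c \<in> annih B'"
    using g(2) by (auto simp: annih_def c)
  have "c \<in> annih B"
    unfolding annih_def using annih_span[OF B'0] B'(3) by blast
  moreover have "dot c v = 1"
    using g(2) by (simp add: c axis_def)
  ultimately show thesis by (rule that)
qed

text \<open>With \<open>e\<close> in \<open>annih B\<close> and \<open>dot e v = 1\<close>, each
  functional killing \<open>B\<close> splits uniquely as \<open>t *s e + c\<close>, where
  \<open>t\<close> is its value at \<open>v\<close> and \<open>c\<close> kills \<open>v\<close> as
  well.\<close>

lemma card_annih_insert:
  fixes B :: "('a::{field,finite} ^ 'n) set"
  assumes "v \<notin> vec.span B"
  shows "card (annih B) = CARD('a) * card (annih (insert v B))"
proof -
  obtain e where e: "e \<in> annih B" "dot e v = 1"
    using assms by (rule annih_separates)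
  have "bij_betw (\<lambda>(t, c). t *s e + c) (UNIV \<times> annih (insert v B)) (annih B)"
    using e
    by (intro bij_betwI[where g = "\<lambda>c. (dot c v, c - dot c v *s e)"])
      (auto simp: annih_def)
  then show ?thesis
    using bij_betw_same_card card_cartesian_product by metis
qed

lemma card_annih_empty: "card (annih ({} :: ('a::{field,finite} ^ 'n) set)) = CARD('a) ^ CARD('n)"
  by (simp add: annih_def)

lemma card_annih:
  fixes B :: "('a::{field,finite} ^ 'n) set"
  assumes "vec.independent B"
  shows "card (annih B) * CARD('a) ^ card B = CARD('a) ^ CARD('n)"
proof -
  have "finite B" by simp
  then show ?thesis using assms
  proof (induction B rule: finite_induct)
    case empty
    then show ?case by (simp add: card_annih_empty)
  next
    case (insert v B)
    have "v \<notin> vec.span B" "vec.independent B"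
      using insert.prems insert.hyps by (simp_all add: vec.independent_insert)
    then show ?case
      using insert.IH insert.hyps card_annih_insert[of v B] by (simp add: mult.assoc mult.left_commute)
  qed
qed

lemma card_annih_power:
  fixes B :: "('a::{field,finite} ^ 'n) set"
  assumes "vec.independent B" "CARD('n) = card B + m"
  shows "card (annih B) = CARD('a) ^ m"
proof -
  have "CARD('a) > 0" by simp
  then show ?thesis
    using card_annih[OF assms(1)] unfolding assms(2) power_add
    by (metis mult.commute mult_cancel1 power_not_zero neq0_conv)
qed

lemma card_annih_minus_zero:
  fixes B :: "('a::{field,finite} ^ 'n) set"
  assumes "vec.independent B" "CARD('n) = card B + m"
  shows "card (annih B - {0}) = CARD('a) ^ m - 1"
  using card_annih_power[OF assms] by (simp add: card_Diff_singleton)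

text \<open>
  Double count of the pairs of a functional \<open>c\<close> and an \<open>i\<close>-subset of \<open>A\<close> on which \<open>c\<close> vanishes.
\<close>

lemma sum_choose_annih:
  fixes A B :: "('a::{field,finite} ^ 'n) set"
  assumes "\<And>T. T \<subseteq> A \<Longrightarrow> card T = i \<Longrightarrow> vec.independent (B \<union> T)"
    and "A \<inter> B = {}" and "CARD('n) = card B + i + m"
  shows "(\<Sum>c\<in>annih B - {0}. card {v\<in>A. dot c v = 0} choose i) =
    (card A choose i) * (CARD('a) ^ m - 1)"
proof -
  define D where "D = {T. T \<subseteq> A \<and> card T = i}"
  have D: "card (annih (B \<union> T) - {0}) = CARD('a) ^ m - 1" if "T \<in> D" for T
  proof (rule card_annih_minus_zero)
    show "vec.independent (B \<union> T)" using assms(1) that by (simp add: D_def)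
    have "card (B \<union> T) = card B + i"
      using that assms(2) by (subst card_Un_disjoint) (auto simp: D_def)
    then show "CARD('n) = card (B \<union> T) + m" using assms(3) by simp
  qed
  have "(\<Sum>c\<in>annih B - {0}. card {v\<in>A. dot c v = 0} choose i)
      = (\<Sum>c\<in>annih B - {0}. card {T\<in>D. c \<in> annih T})"
  proof (rule sum.cong[OF refl])
    fix c
    have "{T\<in>D. c \<in> annih T} = {T. T \<subseteq> {v\<in>A. dot c v = 0} \<and> card T = i}"
      by (auto simp: D_def annih_def)
    then show "(card {v\<in>A. dot c v = 0} choose i) = card {T\<in>D. c \<in> annih T}"
      by (simp add: n_subsets)
  qed
  also have "\<dots> = (\<Sum>c\<in>annih B - {0}. \<Sum>T\<in>D. if c \<in> annih T then 1 else 0)"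
    by (simp add: sum.If_cases Int_def)
  also have "\<dots> = (\<Sum>T\<in>D. \<Sum>c\<in>annih B - {0}. if c \<in> annih T then 1 else 0)"
    by (rule sum.swap)
  also have "\<dots> = (\<Sum>T\<in>D. card (annih (B \<union> T) - {0}))"
  proof (rule sum.cong[OF refl])
    fix T
    have "annih (B \<union> T) - {0} = (annih B - {0}) \<inter> {c. c \<in> annih T}"
      by (auto simp: annih_Un)
    then show "(\<Sum>c\<in>annih B - {0}. if c \<in> annih T then 1 else 0) = card (annih (B \<union> T) - {0})"
      by (simp add: sum.If_cases)
  qed
  also have "\<dots> = card D * (CARD('a) ^ m - 1)"
    using D by simp
  also have "card D = card A choose i"
    by (simp add: D_def n_subsets)
  finally show ?thesis .
qed

subsection \<open>Arcs one point short of the maximum\<close>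

text \<open>When \<open>S\<close> holds one spanning vector per point of an arc, this is the number
  of points of the arc on the hyperplane of \<open>c\<close>.\<close>

definition inc :: "('a::field ^ 'n) set \<Rightarrow> 'a ^ 'n \<Rightarrow> nat" where
  "inc S c = card {v\<in>S. dot c v = 0}"

lemma card_nonzero_multiples:
  fixes c :: "'a::{field,finite} ^ 'n"
  assumes "c \<noteq> 0"
  shows "card ((\<lambda>t. t *s c) ` (UNIV - {0})) = CARD('a) - 1"
proof -
  have "inj_on (\<lambda>t. t *s c) (UNIV - {0})"
    using assms by (auto simp: inj_on_def vec.scale_cancel_right)
  then show ?thesis by (simp add: card_image card_Diff_singleton)
qed

lemma inc_scale: "t \<noteq> 0 \<Longrightarrow> inc S (t *s c) = inc S c"
  by (simp add: inc_def)

lemma choose_2_int: "2 * int (u choose 2) = int u * (int u - 1)"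
proof (induction u)
  case (Suc u)
  then show ?case by (simp add: numeral_2_eq_2 algebra_simps)
qed simp

lemma choose_3_int: "6 * int (u choose 3) = int u * (int u - 1) * (int u - 2)"
proof (induction u)
  case (Suc u)
  have "6 * int (Suc u choose 3) = 3 * (2 * int (u choose 2)) + 6 * int (u choose 3)"
    by (simp add: numeral_3_eq_3 numeral_2_eq_2)
  then show ?case
    unfolding Suc.IH choose_2_int by (simp add: algebra_simps)
qed simp

text \<open>The paper's parameters are \<open>k = j + 3\<close> and \<open>s = e - 1\<close>.\<close>

locale near_maximal =
  fixes S :: "('a::{field,finite} ^ 'n) set" and e j q :: nat
  assumes q_def: "q = CARD('a)"
    and dim: "CARD('n) = j + 3"
    and e_ge: "2 \<le> e" and e_less: "e + 1 < q" and e_dvd: "(e + 1) dvd q"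
    and card_S: "card S = e * (q + 1) + j"
    and bound: "c \<noteq> 0 \<Longrightarrow> inc S c \<le> j + e + 1"
begin

lemma q_gt: "q > 3"
  using e_ge e_less by simp

lemma q_square: "q ^ 2 - 1 = (q - 1) * (q + 1)"
  by (simp add: power2_eq_square algebra_simps)

text \<open>A nonzero functional killing all of \<open>S\<close> would give a hyperplane with
  \<open>card S\<close> points, which exceeds \<open>bound\<close>.\<close>

lemma span_S: "vec.span S = UNIV"
proof (rule ccontr)
  assume "vec.span S \<noteq> UNIV"
  then obtain v where "v \<notin> vec.span S" by blast
  then obtain c where c: "c \<in> annih S" "dot c v = 1"
    by (rule annih_separates)
  then have "inc S c = card S" by (auto simp: inc_def annih_def intro: arg_cong[where f = card])
  moreover have "c \<noteq> 0" using c(2) by auto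
  ultimately have "e * (q + 1) + j \<le> j + e + 1" using bound card_S by metis
  moreover have "2 * 3 \<le> e * q" using e_ge q_gt by (intro mult_le_mono) auto
  ultimately show False by simp
qed

lemma inc_split:
  assumes "B \<subseteq> S" "c \<in> annih B"
  shows "inc S c = card B + card {v\<in>S - B. dot c v = 0}"
proof -
  have "{v\<in>S. dot c v = 0} = B \<union> {v\<in>S - B. dot c v = 0}"
    using assms by (auto simp: annih_def)
  then show ?thesis
    unfolding inc_def by (simp add: card_Un_disjoint disjoint_iff)
qed

text \<open>The span has codimension 2. If it holds \<open>m\<close> points of \<open>S\<close>,
  each of the \<open>q + 1\<close> hyperplanes through it has at most \<open>j + e + 1 - m\<close>
  others. Summing gives \<open>m * q \<le> (j + 1) * q + 1\<close>, which excludes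
  \<open>m \<ge> j + 2\<close>.\<close>

lemma card_span_Int:
  assumes I: "vec.independent I" "card I = j + 1"
  shows "card (S \<inter> vec.span I) \<le> j + 1"
proof (rule ccontr)
  define A where "A = S - vec.span I"
  define m where "m = card (S \<inter> vec.span I)"
  assume "\<not> card (S \<inter> vec.span I) \<le> j + 1"
  then have m: "j + 2 \<le> m" by (simp add: m_def)
  have am: "card A + m = e * (q + 1) + j"
    unfolding A_def m_def card_S[symmetric]
    by (subst card_Un_disjoint[symmetric]) (auto intro: arg_cong[where f = card])
  have "(\<Sum>c\<in>annih I - {0}. card {v\<in>A. dot c v = 0} choose 1) =
      (card A choose 1) * (CARD('a) ^ 1 - 1)"
  proof (rule sum_choose_annih)
    show "vec.independent (I \<union> T)" if "T \<subseteq> A" "card T = 1" for T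
    proof -
      obtain t where "T = {t}" using \<open>card T = 1\<close> by (rule card_1_singletonE)
      moreover have "t \<notin> vec.span I" using \<open>T \<subseteq> A\<close> \<open>T = {t}\<close> by (simp add: A_def)
      ultimately show ?thesis
        using vec.independent_insertI[OF _ I(1), of t] by simp
    qed
    show "A \<inter> I = {}" by (auto simp: A_def intro: vec.span_base)
    show "CARD('n) = card I + 1 + 1" using dim I(2) by simp
  qed
  then have sum: "(\<Sum>c\<in>annih I - {0}. card {v\<in>A. dot c v = 0}) = card A * (q - 1)"
    by (simp add: q_def)
  have W: "card (annih I - {0}) = (q - 1) * (q + 1)"
    using card_annih_minus_zero[OF I(1), of 2] dim I(2) q_square by (simp add: q_def)
  have le: "card {v\<in>A. dot c v = 0} + m \<le> j + e + 1" if "c \<in> annih I - {0}" for c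
  proof -
    have "{v\<in>S. dot c v = 0} = {v\<in>A. dot c v = 0} \<union> (S \<inter> vec.span I)"
      using annih_span[of c I] that by (auto simp: A_def)
    then have "inc S c = card {v\<in>A. dot c v = 0} + m"
      unfolding inc_def m_def by (simp add: card_Un_disjoint disjoint_iff A_def)
    then show ?thesis using bound[of c] that by simp
  qed
  have "(\<Sum>c\<in>annih I - {0}. card {v\<in>A. dot c v = 0} + m) \<le>
      (\<Sum>c\<in>annih I - {0}. j + e + 1)"
    using le by (rule sum_mono)
  then have "(q - 1) * (card A + m * (q + 1)) \<le> (q - 1) * ((j + e + 1) * (q + 1))"
    unfolding sum.distrib sum sum_constant W by (simp only: distrib_left mult_ac of_nat_id)
  then have "card A + m * (q + 1) \<le> (j + e + 1) * (q + 1)"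
    using q_gt by (simp only: mult_le_cancel1)
  then have "m * q \<le> (j + 1) * q + 1"
    using am by (simp add: algebra_simps)
  moreover have "(j + 2) * q \<le> m * q"
    using m by (rule mult_le_mono1)
  ultimately show False using q_gt by simp
qed

text \<open>A dependent \<open>T\<close> has a maximal independent part \<open>I0\<close> with at
  most \<open>j + 1\<close> elements. Enlarged inside \<open>S\<close> to exactly
  \<open>j + 1\<close> independent vectors, its span also contains a leftover \<open>t\<close> from
  \<open>T\<close>, against \<open>card_span_Int\<close>.\<close>

lemma independent_subset:
  assumes T: "T \<subseteq> S" "card T \<le> j + 2"
  shows "vec.independent T"
proof (rule ccontr)
  assume dep: "\<not> vec.independent T"
  obtain I0 where I0: "I0 \<subseteq> T" "vec.independent I0" "T \<subseteq> vec.span I0"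
    by (rule vec.maximal_independent_subset)
  have "T \<noteq> I0" using I0(2) dep by metis
  then obtain t where t: "t \<in> T" "t \<notin> I0"
    using I0(1) by blast
  have "card I0 < card T"
    using I0(1) t by (intro psubset_card_mono) auto
  obtain I where I: "I0 \<subseteq> I" "I \<subseteq> S" "vec.independent I" "S \<subseteq> vec.span I"
    using vec.maximal_independent_subset_extend[of I0 S] I0 T by blast
  have "vec.span I = UNIV"
    using vec.span_mono[OF I(4)] span_S by (simp add: vec.span_span top.extremum_unique)
  then have "card I = j + 3"
    using vec.dim_eq_card[of I UNIV] I(3) dim vec.dim_UNIV
    by (simp add: vec.dimension_def card_cart_basis)
  then obtain I1 where I1: "I0 \<subseteq> I1" "I1 \<subseteq> I" "card I1 = j + 1"
    using exists_subset_between[of I0 "j + 1" I] I(1) \<open>card I0 < card T\<close> T(2) by auto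
  have "t \<in> vec.span I0" using I0 t by blast
  \<comment> \<open>Otherwise \<open>t\<close> would belong to the basis \<open>I\<close> and still
    lie in the span of the other basis vectors, since \<open>I0\<close> spans it.\<close>
  have "t \<notin> I1"
  proof
    assume "t \<in> I1"
    then have "t \<in> I" "I0 \<subseteq> I - {t}" using I1 t I by auto
    then have "t \<in> vec.span (I - {t})"
      using \<open>t \<in> vec.span I0\<close> vec.span_mono by blast
    then show False using I(3) \<open>t \<in> I\<close> by (auto simp: vec.dependent_def)
  qed
  have "insert t I1 \<subseteq> S \<inter> vec.span I1"
    using I I1 t T \<open>t \<in> vec.span I0\<close> vec.span_mono[OF I1(1)] vec.span_base by blast
  then have "card (insert t I1) \<le> card (S \<inter> vec.span I1)"
    by (intro card_mono) auto
  moreover have "vec.independent I1"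
    using I(3) I1(2) vec.independent_mono by blast
  ultimately show False
    using card_span_Int[of I1] I1(3) \<open>t \<notin> I1\<close> by simp
qed

text \<open>The binomial moments of the number of further points on a hyperplane through
  \<open>B\<close>. The cap \<open>j + 2\<close> is the size up to which
  \<open>independent_subset\<close> guarantees independence.\<close>

lemma sum_choose_inc:
  assumes "B \<subseteq> S" "card B + i \<le> j + 2" "j + 3 = card B + i + m"
  shows "(\<Sum>c\<in>annih B - {0}. card {v\<in>S - B. dot c v = 0} choose i) =
    (card (S - B) choose i) * (q ^ m - 1)"
  unfolding q_def
proof (rule sum_choose_annih)
  show "vec.independent (B \<union> T)" if "T \<subseteq> S - B" "card T = i" for T
    using that assms card_Un_le[of B T] by (intro independent_subset) auto
qed (use assms dim in auto)

text \<open>Each of the \<open>q + 1\<close> hyperplanes through \<open>B\<close> has room for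
  \<open>e\<close> further points, and \<open>e * (q + 1) - 1\<close> points remain to be placed. So
  exactly one place stays free, counted \<open>q - 1\<close> times.\<close>

lemma sum_deficit:
  assumes B: "B \<subseteq> S" "card B = j + 1"
  shows "(\<Sum>c\<in>annih B - {0}. j + e + 1 - inc S c) = q - 1"
proof -
  have cA: "card (S - B) + 1 = e * (q + 1)"
    using B card_S e_ge by (simp add: card_Diff_subset)
  have W: "card (annih B - {0}) = (q - 1) * (q + 1)"
    using card_annih_minus_zero[of B 2] independent_subset[of B] B dim q_square
    by (simp add: q_def)
  have "(\<Sum>c\<in>annih B - {0}. inc S c) =
      (\<Sum>c\<in>annih B - {0}. (j + 1) + card {v\<in>S - B. dot c v = 0})"
    using B by (intro sum.cong refl) (simp add: inc_split)
  also have "\<dots> = (j + 1) * ((q - 1) * (q + 1)) + card (S - B) * (q - 1)"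
    using sum_choose_inc[of B 1 1] B
    by (simp only: sum.distrib sum_constant W choose_one power_one_right) simp
  finally have inc: "(\<Sum>c\<in>annih B - {0}. inc S c) =
      (j + 1) * ((q - 1) * (q + 1)) + card (S - B) * (q - 1)" .
  \<comment> \<open>Adding the counts back avoids reasoning about natural-number differences;
    \<open>bound\<close> ensures that none of them truncates.\<close>
  have "(\<Sum>c\<in>annih B - {0}. j + e + 1 - inc S c) + (\<Sum>c\<in>annih B - {0}. inc S c)
      = (\<Sum>c\<in>annih B - {0}. j + e + 1)"
    unfolding sum.distrib[symmetric] using bound by (intro sum.cong refl) auto
  also have "\<dots> = (j + 1) * ((q - 1) * (q + 1)) + (card (S - B) + 1) * (q - 1)"
    unfolding sum_constant W cA by (simp only: distrib_left distrib_right mult_ac of_nat_id add_ac)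
  finally show ?thesis unfolding inc by (simp add: algebra_simps)
qed

text \<open>All \<open>q - 1\<close> nonzero multiples of \<open>c\<close> share its deficit, and
  the total deficit through \<open>j + 1\<close> of its points is \<open>q - 1\<close>. Hence the
  deficit of \<open>c\<close> is at most 1.\<close>

lemma inc_ge:
  assumes c: "c \<noteq> 0" "j + 1 \<le> inc S c"
  shows "j + e \<le> inc S c"
proof -
  obtain B where B: "B \<subseteq> {v\<in>S. dot c v = 0}" "card B = j + 1"
    using c(2) unfolding inc_def by (rule obtain_subset_with_card_n) blast
  let ?C = "(\<lambda>t. t *s c) ` (UNIV - {0})"
  have "(q - 1) * (j + e + 1 - inc S c) = (\<Sum>c'\<in>?C. j + e + 1 - inc S c)"
    using card_nonzero_multiples[OF c(1)] by (simp add: q_def)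
  also have "\<dots> = (\<Sum>c'\<in>?C. j + e + 1 - inc S c')"
    by (intro sum.cong refl, elim imageE) (simp add: inc_scale)
  also have "\<dots> \<le> (\<Sum>c'\<in>annih B - {0}. j + e + 1 - inc S c')"
    using B(1) c(1) by (intro sum_mono2) (auto simp: annih_def)
  also have "\<dots> = (q - 1) * 1"
    using sum_deficit[of B] B by auto
  finally show ?thesis
    using q_gt by (simp only: mult_le_cancel1) linarith
qed

end

subsection \<open>Nonexistence in dimension greater than two\<close>

text \<open>Up to a factor \<open>q - 1\<close>, this is the sum of
  \<open>(u - 1) * (u - d) * (u - (d + 1))\<close> over the hyperplanes through \<open>k - 4\<close>
  points of the arc; \<open>x\<close> is the number of remaining points.\<close>

lemma third_moment_pos:
  fixes d q x :: int
  assumes "q = d * m" "d \<ge> 3" "m \<ge> 2" "x = (d - 1) * (q + 1) + 1"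
  shows "x * (x - 1) * (x - 2) + (1 - 2 * d) * (x * (x - 1)) * (q + 1) +
    d * (d + 1) * x * (q ^ 2 + q + 1)
    - d * (d + 1) * (q ^ 3 + q ^ 2 + q + 1) > 0"
proof -
  \<comment> \<open>Shifting both parameters to start at 0 leaves a polynomial with nonnegative
    coefficients and constant term 12.\<close>
  define a b where "a = d - 3" and "b = m - 2"
  have d: "d = a + 3" and m: "m = b + 2" and ab: "a \<ge> 0" "b \<ge> 0"
    using assms by (simp_all add: a_def b_def)
  have "x * (x - 1) * (x - 2) + (1 - 2 * d) * (x * (x - 1)) * (q + 1) +
    d * (d + 1) * x * (q ^ 2 + q + 1)
    - d * (d + 1) * (q ^ 3 + q ^ 2 + q + 1) =
    12 + 42 * b + 18 * b ^ 2
    + a * (406 + 785 * b + 453 * b ^ 2 + 81 * b ^ 3)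
    + a ^ 2 * (500 + 968 * b + 575 * b ^ 2 + 108 * b ^ 3)
    + a ^ 3 * (236 + 462 * b + 280 * b ^ 2 + 54 * b ^ 3)
    + a ^ 4 * (50 + 99 * b + 61 * b ^ 2 + 12 * b ^ 3)
    + a ^ 5 * (4 + 8 * b + 5 * b ^ 2 + b ^ 3)"
    unfolding assms(4) assms(1) d m by algebra
  also have "\<dots> > 0"
    using ab by (intro add_pos_nonneg mult_nonneg_nonneg add_nonneg_nonneg) auto
  finally show ?thesis .
qed

context near_maximal
begin

lemma q_factor: obtains m where "q = (e + 1) * m" "m \<ge> 2"
proof -
  obtain m where m: "q = (e + 1) * m" using e_dvd by blast
  have "m \<noteq> 0" using m e_less by (intro notI) simp
  moreover have "m \<noteq> 1" using m e_less by auto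
  ultimately show thesis using that[OF m] by linarith
qed

lemma j_eq_0: "j = 0"
proof (rule ccontr)
  assume "j \<noteq> 0"
  \<comment> \<open>With \<open>i = k - 4\<close> points fixed, three more still make an independent
    set of \<open>j + 2\<close>, so moments up to the third are available.\<close>
  then obtain i where i: "j = i + 1" by (metis Suc_eq_plus1 not0_implies_Suc)
  have "i \<le> card S" using card_S i by simp
  then obtain B where B: "B \<subseteq> S" "card B = i"
    by (rule obtain_subset_with_card_n)
  define W where "W = annih B - {0}"
  define u where "u c = card {v\<in>S - B. dot c v = 0}" for c
  define d x Q where "d = int e + 1" and "x = int (card (S - B))" and "Q = int q"
  have x: "x = (d - 1) * (Q + 1) + 1"
    using B card_S i by (simp add: card_Diff_subset x_def d_def Q_def algebra_simps)
  \<comment> \<open>The exponent is \<open>4 - l\<close>, because \<open>i + l\<close> independent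
    vectors have an annihilator of dimension \<open>j + 3 - (i + l)\<close>.\<close>
  have M: "(\<Sum>c\<in>W. int (u c choose l)) = int (card (S - B) choose l) * (Q ^ m - 1)"
    if "l \<le> 3" "m + l = 4" for l m
  proof -
    have "int (\<Sum>c\<in>W. u c choose l) = int ((card (S - B) choose l) * (q ^ m - 1))"
      unfolding W_def u_def using that i B by (subst sum_choose_inc) auto
    also have "\<dots> = int (card (S - B) choose l) * (Q ^ m - 1)"
      using q_gt by (simp add: Q_def of_nat_diff)
    finally show ?thesis by simp
  qed
  \<comment> \<open>The cubic is rewritten in the binomial basis, to which the moments apply term by
    term.\<close>
  have f: "(int n - 1) * (int n - d) * (int n - (d + 1)) =
      6 * int (n choose 3) + (1 - 2 * d) * (2 * int (n choose 2)) + d * (d + 1) * int (n choose 1)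
      - d * (d + 1) * int (n choose 0)" for n
    unfolding choose_2_int choose_3_int choose_one binomial_n_0 by (simp add: algebra_simps power2_eq_square)
  have "(\<Sum>c\<in>W. (int (u c) - 1) * (int (u c) - d) * (int (u c) - (d + 1))) =
      6 * (int (card (S - B) choose 3) * (Q ^ 1 - 1)) +
      (1 - 2 * d) * (2 * (int (card (S - B) choose 2) * (Q ^ 2 - 1))) +
      d * (d + 1) * (int (card (S - B) choose 1) * (Q ^ 3 - 1)) -
      d * (d + 1) * (int (card (S - B) choose 0) * (Q ^ 4 - 1))"
    unfolding f sum.distrib sum_subtractf sum_distrib_left[symmetric]
    by (subst (1 2 3 4) M) auto
  also have "\<dots> = (6 * int (card (S - B) choose 3)) * (Q - 1) +
      (1 - 2 * d) * (2 * int (card (S - B) choose 2)) * (Q ^ 2 - 1) +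
      d * (d + 1) * x * (Q ^ 3 - 1) - d * (d + 1) * (Q ^ 4 - 1)"
    by (simp add: x_def)
  also have "\<dots> = (Q - 1) * (x * (x - 1) * (x - 2) + (1 - 2 * d) * (x * (x - 1)) * (Q + 1) +
      d * (d + 1) * x * (Q ^ 2 + Q + 1) - d * (d + 1) * (Q ^ 3 + Q ^ 2 + Q + 1))"
    unfolding choose_2_int choose_3_int x_def[symmetric] by algebra
  also have "\<dots> > 0"
  proof (rule mult_pos_pos)
    obtain m where m: "q = (e + 1) * m" "m \<ge> 2" by (rule q_factor)
    have "Q = int ((e + 1) * m)" using m(1) by (simp only: Q_def)
    also have "\<dots> = d * int m" by (simp add: d_def algebra_simps)
    finally show "0 < x * (x - 1) * (x - 2) + (1 - 2 * d) * (x * (x - 1)) * (Q + 1) +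
      d * (d + 1) * x * (Q ^ 2 + Q + 1) - d * (d + 1) * (Q ^ 3 + Q ^ 2 + Q + 1)"
      using e_ge m(2) x by (intro third_moment_pos[where m = "int m"]) (auto simp: d_def)
  qed (use q_gt in \<open>simp add: Q_def\<close>)
  finally have pos: "(\<Sum>c\<in>W. (int (u c) - 1) * (int (u c) - d) * (int (u c) - (d + 1))) > 0" .
  have "(int (u c) - 1) * (int (u c) - d) * (int (u c) - (d + 1)) \<le> 0" if "c \<in> W" for c
  proof -
    have inc: "inc S c = i + u c"
      using inc_split[of B c] B that by (auto simp: W_def u_def)
    have "c \<noteq> 0" using that by (simp add: W_def)
    \<comment> \<open>Two further points make \<open>j + 1\<close> in all, so \<open>inc_ge\<close>
      applies. The remaining values 1, \<open>d\<close> and \<open>d + 1\<close> are roots of the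
      cubic, and at 0 it is negative.\<close>
    then have "u c \<le> e + 2" "u c \<ge> 2 \<Longrightarrow> u c \<ge> e + 1"
      using bound[of c] inc_ge[of c] inc i by auto
    then consider "u c = 0" | "u c = 1" | "u c = e + 1" | "u c = e + 2"
      by linarith
    then show ?thesis by cases (auto simp: d_def mult_le_0_iff)
  qed
  then have "(\<Sum>c\<in>W. (int (u c) - 1) * (int (u c) - d) * (int (u c) - (d + 1))) \<le> 0"
    by (rule sum_nonpos)
  with pos show False by simp
qed

end

subsection \<open>The tangents of a plane arc\<close>

lemma span_singleton_swap:
  fixes v y :: "'a::{field,finite} ^ 'n"
  assumes "v \<noteq> 0" "v \<in> vec.span {y}"
  shows "y \<in> vec.span {v}" "annih {v} = annih {y}"
proof -
  obtain t where t: "v = t *s y" using assms(2) by (auto simp: vec.span_singleton)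
  then have "t \<noteq> 0" using assms(1) by auto
  then have "y = inverse t *s v" using t by (simp add: vec.scale_scale)
  then show "y \<in> vec.span {v}" by (auto simp: vec.span_singleton)
  show "annih {v} = annih {y}" using t \<open>t \<noteq> 0\<close> by (auto simp: annih_def)
qed

lemma independent_pair:
  fixes x y :: "'a::{field,finite} ^ 'n"
  assumes "x \<noteq> 0" "y \<notin> vec.span {x}"
  shows "vec.independent {x, y}" "x \<noteq> y"
proof -
  show "x \<noteq> y" using assms(2) vec.span_base by blast
  have "vec.independent {x}" using assms(1) by simp
  then have "vec.independent (insert y {x})" using assms(2) vec.independent_insertI by blast
  then show "vec.independent {x, y}" by (simp add: insert_commute)
qed

context near_maximal
begin

text \<open>By \<open>inc_cases\<close> a line meets the arc in 0, \<open>e\<close> or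
  \<open>e + 1\<close> points, so \<open>e\<close> is the only count possible for a tangent. Each
  tangent contributes its \<open>q - 1\<close> functionals.\<close>

definition tangents :: "('a ^ 'n) set" where
  "tangents = {c. c \<noteq> 0 \<and> inc S c = e}"

lemma dim_3: "CARD('n) = 3"
  using dim j_eq_0 by simp

lemma card_S_plane: "card S = e * (q + 1)"
  using card_S j_eq_0 by simp

lemma inc_cases:
  assumes "c \<noteq> 0"
  obtains "inc S c = 0" | "inc S c = e" | "inc S c = e + 1"
  using bound[OF assms] inc_ge[OF assms] j_eq_0 by force

lemma S_nonzero: "v \<in> S \<Longrightarrow> v \<noteq> 0"
  using independent_subset[of "{v}"] j_eq_0 by auto

lemma card_annih_point:
  fixes v :: "'a ^ 'n"
  assumes "v \<noteq> 0"
  shows "card (annih {v} - {0}) = (q - 1) * (q + 1)"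
  using card_annih_minus_zero[of "{v}" 2] assms dim_3 q_square by (simp add: q_def)

lemma scale_in_tangents: "c \<in> tangents \<Longrightarrow> t \<noteq> 0 \<Longrightarrow> t *s c \<in> tangents"
  by (simp add: tangents_def inc_scale)

text \<open>Among the lines through a point of \<open>S\<close>, tangents have deficit 1 and secants
  0. So \<open>sum_deficit\<close> counts tangents: there is exactly one.\<close>

lemma card_tangents_at:
  assumes "v \<in> S"
  shows "card {c\<in>tangents. dot c v = 0} = q - 1"
proof -
  have "(\<Sum>c\<in>annih {v} - {0}. if c \<in> tangents then 1 else 0) =
      (\<Sum>c\<in>annih {v} - {0}. j + e + 1 - inc S c)"
  proof (rule sum.cong[OF refl])
    fix c assume c: "c \<in> annih {v} - {0}"
    then have "v \<in> {v\<in>S. dot c v = 0}" using assms by (simp add: annih_def)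
    then have "inc S c \<noteq> 0" by (auto simp: inc_def card_eq_0_iff)
    with c have "c \<noteq> 0" "inc S c \<noteq> 0" by auto
    then show "(if c \<in> tangents then 1 else 0) = j + e + 1 - inc S c"
      by (cases rule: inc_cases) (use c in \<open>auto simp: tangents_def j_eq_0\<close>)
  qed
  also have "\<dots> = q - 1"
    using assms j_eq_0 by (intro sum_deficit) auto
  finally have "card ((annih {v} - {0}) \<inter> tangents) = q - 1"
    by (simp add: sum.If_cases)
  moreover have "(annih {v} - {0}) \<inter> tangents = {c\<in>tangents. dot c v = 0}"
    by (auto simp: annih_def tangents_def)
  ultimately show ?thesis by simp
qed

text \<open>Double count of incidences: a tangent holds \<open>e\<close> points, each of the
  \<open>e * (q + 1)\<close> points lies on one tangent, so there are \<open>q + 1\<close>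
  tangents.\<close>

lemma card_tangents: "card tangents = (q - 1) * (q + 1)"
proof -
  have "e * card tangents = (\<Sum>c\<in>tangents. inc S c)"
    by (simp add: tangents_def)
  also have "\<dots> = (\<Sum>c\<in>tangents. \<Sum>v\<in>S. if dot c v = 0 then 1 else 0)"
    by (simp add: inc_def sum.If_cases Int_def)
  also have "\<dots> = (\<Sum>v\<in>S. \<Sum>c\<in>tangents. if dot c v = 0 then 1 else 0)"
    by (rule sum.swap)
  also have "\<dots> = (\<Sum>v\<in>S. card {c\<in>tangents. dot c v = 0})"
    by (simp add: sum.If_cases Int_def)
  also have "\<dots> = e * ((q - 1) * (q + 1))"
  proof -
    have "(\<Sum>v\<in>S. card {c\<in>tangents. dot c v = 0}) = (\<Sum>v\<in>S. q - 1)"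
      by (intro sum.cong refl card_tangents_at)
    then show ?thesis
      unfolding sum_constant card_S_plane of_nat_id by (simp only: mult_ac)
  qed
  finally show ?thesis using e_ge by (simp only: mult_cancel1) simp
qed

text \<open>Every point of \<open>S\<close> is joined to the point of \<open>y\<close> by exactly
  one line.\<close>

lemma sum_inc_outside:
  assumes "y \<noteq> 0" "\<And>v. v \<in> S \<Longrightarrow> v \<notin> vec.span {y}"
  shows "(\<Sum>c\<in>annih {y} - {0}. inc S c) = e * ((q - 1) * (q + 1))"
proof -
  have "(\<Sum>c\<in>annih {y} - {0}. card {v\<in>S. dot c v = 0} choose 1) =
      (card S choose 1) * (CARD('a) ^ 1 - 1)"
  proof (rule sum_choose_annih)
    show "vec.independent ({y} \<union> T)" if T: "T \<subseteq> S" "card T = 1" for T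
    proof -
      obtain t where "T = {t}" using T(2) by (rule card_1_singletonE)
      then show ?thesis using independent_pair(1)[of y t] assms T(1) by (simp add: insert_commute)
    qed
    show "S \<inter> {y} = {}" using assms(2) vec.span_base by blast
    show "CARD('n) = card {y} + 1 + 1" using dim_3 by simp
  qed
  then show ?thesis
    unfolding inc_def choose_one power_one_right card_S_plane q_def[symmetric] by (simp only: mult_ac)
qed

text \<open>
  A point outside \<open>S\<close> on no tangent would have \<open>(e + 1) b = e (q\<^sup>2 - 1)\<close> for some \<open>b\<close>, which is
  impossible since \<open>e + 1\<close> divides \<open>q\<close>.
\<close>

lemma point_on_tangent:
  assumes "z \<noteq> 0"
  obtains c where "c \<in> tangents" "dot c z = 0"
proof (cases "\<exists>v\<in>S. v \<in> vec.span {z}")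
  case True
  then obtain v where v: "v \<in> S" "v \<in> vec.span {z}" by blast
  have "card {c\<in>tangents. dot c v = 0} \<noteq> 0"
    using card_tangents_at[OF v(1)] q_gt by simp
  then obtain c where "c \<in> tangents" "dot c v = 0"
    by (metis (mono_tags, lifting) Collect_empty_eq card.empty)
  moreover have "annih {v} = annih {z}"
    using span_singleton_swap(2) S_nonzero v by blast
  ultimately show thesis using that annih_iff_singleton by blast
next
  case False
  show thesis
  proof (rule ccontr)
    assume "\<not> thesis"
    then have no: "c \<in> tangents \<Longrightarrow> dot c z \<noteq> 0" for c
      using that by blast
    have "(e + 1) dvd (\<Sum>c\<in>annih {z} - {0}. inc S c)"
    proof (rule dvd_sum)
      fix c assume c: "c \<in> annih {z} - {0}"
      then have "c \<noteq> 0" "c \<notin> tangents" using no by (auto simp: annih_def)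
      then show "(e + 1) dvd inc S c"
        by (cases rule: inc_cases) (use \<open>c \<noteq> 0\<close> \<open>c \<notin> tangents\<close> in \<open>auto simp: tangents_def\<close>)
    qed
    then have "(e + 1) dvd e * ((q - 1) * (q + 1))"
      using sum_inc_outside[of z] assms False by auto
    \<comment> \<open>The extra \<open>e + 1\<close> turns the number into
      \<open>e * q * q + 1\<close>, which is 1 modulo \<open>e + 1\<close>.\<close>
    then have "(e + 1) dvd e * ((q - 1) * (q + 1)) + (e + 1)"
      by (rule dvd_add) (rule dvd_refl)
    also have "e * ((q - 1) * (q + 1)) + (e + 1) = e * q * q + 1"
    proof -
      obtain p where "q = p + 1" using q_gt by (cases q) auto
      then show ?thesis by (simp add: algebra_simps)
    qed
    finally have "(e + 1) dvd e * q * q + 1" .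
    then have "(e + 1) dvd 1"
      using e_dvd by (simp only: dvd_add_right_iff dvd_mult)
    then show False using e_ge by simp
  qed
qed

lemma card_tangents_ge:
  assumes "z \<noteq> 0"
  shows "q - 1 \<le> card {t\<in>tangents. dot t z = 0}"
proof -
  obtain c where c: "c \<in> tangents" "dot c z = 0" using assms by (rule point_on_tangent)
  have "card ((\<lambda>t. t *s c) ` (UNIV - {0})) \<le> card {t\<in>tangents. dot t z = 0}"
    using c by (intro card_mono) (auto simp: scale_in_tangents)
  then show ?thesis using c(1) by (simp add: card_nonzero_multiples tangents_def q_def)
qed

text \<open>Let \<open>y\<close> be the meet of two tangents. A non-tangent line through
  \<open>y\<close> meets each of the \<open>q + 1\<close> tangents in one point, and each of its
  \<open>q + 1\<close> points is on some tangent, hence on only one; but \<open>y\<close> is on two.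
  So all \<open>q + 1\<close> lines through \<open>y\<close> are tangents, and there are no
  others.\<close>

lemma tangents_pencil:
  obtains y where "y \<noteq> 0" "tangents = annih {y} - {0}"
proof -
  have "tangents \<noteq> {}" using card_tangents q_gt by auto
  then obtain c1 where c1: "c1 \<in> tangents" by blast
  then have c1_0: "c1 \<noteq> 0" by (simp add: tangents_def)
  have "\<not> tangents \<subseteq> (\<lambda>t. t *s c1) ` (UNIV - {0})"
  proof
    assume "tangents \<subseteq> (\<lambda>t. t *s c1) ` (UNIV - {0})"
    then have "card tangents \<le> card ((\<lambda>t. t *s c1) ` (UNIV - {0}))"
      by (intro card_mono) auto
    then have "(q - 1) * (q + 1) \<le> (q - 1) * 1"
      using card_tangents card_nonzero_multiples[OF c1_0] by (simp add: q_def)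
    then show False using q_gt by (simp only: mult_le_cancel1) simp
  qed
  then obtain c2 where c2: "c2 \<in> tangents" "c2 \<notin> (\<lambda>t. t *s c1) ` (UNIV - {0})" by blast
  then have c2_0: "c2 \<noteq> 0" by (simp add: tangents_def)
  have c12: "c2 \<notin> vec.span {c1}"
  proof
    assume "c2 \<in> vec.span {c1}"
    then obtain t where "c2 = t *s c1" by (auto simp: vec.span_singleton)
    then show False using c2(2) c2_0 by (cases "t = 0") auto
  qed
  have "card (annih {c1, c2} - {0}) = q - 1"
    using card_annih_minus_zero[of "{c1, c2}" 1] independent_pair[OF c1_0 c12] dim_3
    by (simp add: q_def)
  then have "annih {c1, c2} - {0} \<noteq> {}" using q_gt by (intro notI) simp
  then obtain y where y: "y \<noteq> 0" "dot c1 y = 0" "dot c2 y = 0"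
    by (auto simp: annih_def dot_commute)
  have "annih {y} - {0} \<subseteq> tangents"
  proof (rule ccontr)
    assume "\<not> annih {y} - {0} \<subseteq> tangents"
    then obtain c where c: "c \<noteq> 0" "dot c y = 0" "c \<notin> tangents"
      by (auto simp: annih_def)
    define Z where "Z = annih {c} - {0}"
    have "(\<Sum>z\<in>Z. card {t\<in>tangents. dot t z = 0}) =
        (\<Sum>z\<in>Z. \<Sum>t\<in>tangents. if dot t z = 0 then 1 else 0)"
      by (simp add: sum.If_cases Int_def)
    also have "\<dots> = (\<Sum>t\<in>tangents. \<Sum>z\<in>Z. if dot t z = 0 then 1 else 0)"
      by (rule sum.swap)
    also have "\<dots> = (\<Sum>t\<in>tangents. q - 1)"
    proof (rule sum.cong[OF refl])
      fix t assume t: "t \<in> tangents"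
      \<comment> \<open>If \<open>c\<close> and \<open>t\<close> were proportional, \<open>c\<close>
        would be a tangent too. So the two lines are distinct and meet in one point.\<close>
      have "t \<notin> vec.span {c}"
      proof
        assume "t \<in> vec.span {c}"
        then have "c \<in> vec.span {t}"
          using t by (intro span_singleton_swap(1)[of t c]) (auto simp: tangents_def)
        then obtain a where "c = a *s t" by (auto simp: vec.span_singleton)
        then show False using c t scale_in_tangents[of t a] by (cases "a = 0") auto
      qed
      then have "card (annih {c, t} - {0}) = q - 1"
        using card_annih_minus_zero[of "{c, t}" 1] independent_pair[OF c(1), of t] dim_3
        by (simp add: q_def)
      moreover have "annih {c, t} - {0} = Z \<inter> {z. dot t z = 0}"
        by (auto simp: Z_def annih_def dot_commute)
      ultimately show "(\<Sum>z\<in>Z. if dot t z = 0 then 1 else 0) = q - 1"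
        by (simp add: sum.If_cases)
    qed
    also have "\<dots> = (\<Sum>z\<in>Z. q - 1)"
      using card_tangents card_annih_point[OF c(1)] by (simp add: Z_def)
    finally have eq: "(\<Sum>z\<in>Z. card {t\<in>tangents. dot t z = 0}) = (\<Sum>z\<in>Z. q - 1)" .
    have "(\<Sum>z\<in>Z. q - 1) < (\<Sum>z\<in>Z. card {t\<in>tangents. dot t z = 0})"
    proof (rule sum_strict_mono_ex1)
      show "\<forall>z\<in>Z. q - 1 \<le> card {t\<in>tangents. dot t z = 0}"
        by (intro ballI card_tangents_ge) (simp add: Z_def)
      have "y \<in> Z" using c(2) y(1) dot_commute[of c y] by (simp add: Z_def annih_def)
      moreover have "q - 1 < card {t\<in>tangents. dot t y = 0}"
      proof -
        have "card (insert c2 ((\<lambda>t. t *s c1) ` (UNIV - {0}))) \<le> card {t\<in>tangents. dot t y = 0}"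
          using c1 c2 y by (intro card_mono) (auto simp: scale_in_tangents)
        then show ?thesis
          using c2(2) card_nonzero_multiples[OF c1_0] q_gt by (simp add: q_def)
      qed
      ultimately show "\<exists>z\<in>Z. q - 1 < card {t\<in>tangents. dot t z = 0}" by blast
    qed simp
    with eq show False by simp
  qed
  then have "annih {y} - {0} = tangents"
    by (rule card_subset_eq[OF finite]) (simp only: card_tangents card_annih_point[OF y(1)])
  then show thesis using that y(1) by blast
qed

text \<open>Only one of the \<open>q + 1\<close> lines through a point of \<open>S\<close> is a
  tangent, and none is external. This later shows that the centre of the pencil is outside the
  arc.\<close>

lemma exists_secant:
  assumes "v \<in> S"
  obtains c where "c \<noteq> 0" "dot c v = 0" "inc S c = e + 1"
proof -
  have "\<not> annih {v} - {0} \<subseteq> {c\<in>tangents. dot c v = 0}"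
  proof
    assume "annih {v} - {0} \<subseteq> {c\<in>tangents. dot c v = 0}"
    then have "card (annih {v} - {0}) \<le> card {c\<in>tangents. dot c v = 0}"
      by (intro card_mono) auto
    then have "(q - 1) * (q + 1) \<le> (q - 1) * 1"
      using card_annih_point[OF S_nonzero[OF assms]] card_tangents_at[OF assms] by simp
    then show False using q_gt by (simp only: mult_le_cancel1) simp
  qed
  then obtain c where c: "c \<noteq> 0" "dot c v = 0" "inc S c \<noteq> e"
    by (auto simp: annih_def tangents_def)
  moreover have "inc S c \<noteq> 0"
    using c(2) assms by (auto simp: inc_def card_eq_0_iff)
  ultimately show thesis using that inc_cases[OF c(1)] by metis
qed

text \<open>The lines through \<open>y\<close> hold \<open>e\<close> points on average, so if none
  holds more than \<open>e\<close>, all hold exactly \<open>e\<close>. Any point extending the arc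
  satisfies this condition.\<close>

lemma tangents_eq_annih:
  assumes y: "y \<noteq> 0" "\<And>v. v \<in> S \<Longrightarrow> v \<notin> vec.span {y}"
    and le: "\<And>c. c \<noteq> 0 \<Longrightarrow> dot c y = 0 \<Longrightarrow> inc S c \<le> e"
  shows "tangents = annih {y} - {0}"
proof -
  have eq: "(\<Sum>c\<in>annih {y} - {0}. inc S c) = (\<Sum>c\<in>annih {y} - {0}. e)"
    using sum_inc_outside[OF y] unfolding sum_constant card_annih_point[OF y(1)]
    by (simp only: mult_ac of_nat_id)
  have "inc S c \<le> e" if "c \<in> annih {y} - {0}" for c
    using le that by (simp add: annih_def)
  then have "inc S c = e" if "c \<in> annih {y} - {0}" for c
    using sum_mono_inv[OF eq _ that finite] by simp
  then have "annih {y} - {0} \<subseteq> tangents" by (auto simp: tangents_def)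
  then have "annih {y} - {0} = tangents"
    by (rule card_subset_eq[OF finite]) (simp only: card_tangents card_annih_point[OF y(1)])
  then show ?thesis by simp
qed

text \<open>Otherwise some functional kills \<open>y\<close> but not \<open>y'\<close>: a tangent
  that misses \<open>y'\<close>.\<close>

lemma tangents_center_unique:
  assumes "tangents = annih {y} - {0}" "\<And>c. c \<in> tangents \<Longrightarrow> dot c y' = 0"
  shows "y' \<in> vec.span {y}"
proof (rule ccontr)
  assume "y' \<notin> vec.span {y}"
  then obtain c where "c \<in> annih {y}" "dot c y' = 1"
    by (rule annih_separates)
  then show False using assms by (cases "c = 0") auto
qed

end

subsection \<open>Points and hyperplanes of the projective space\<close>

lemma pg_points_iff: "P \<in> pg_points \<longleftrightarrow> (\<exists>v. v \<noteq> 0 \<and> P = vec.span {v})"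
proof
  assume "P \<in> pg_points"
  then have P: "vec.subspace P" "vec.dim P = 1" by (auto simp: pg_points_def)
  obtain B where B: "B \<subseteq> P" "vec.independent B" "P \<subseteq> vec.span B" "card B = vec.dim P"
    by (rule vec.basis_exists)
  have "card B = 1" using B(4) P(2) by simp
  then obtain v where v: "B = {v}" by (rule card_1_singletonE)
  have "vec.span B = P" using B P(1) by (intro vec.span_subspace)
  then show "\<exists>v. v \<noteq> 0 \<and> P = vec.span {v}" using B(2) v by auto
next
  assume "\<exists>v. v \<noteq> 0 \<and> P = vec.span {v}"
  then obtain v where v: "v \<noteq> 0" "P = vec.span {v}" by blast
  have "vec.independent {v}" using v(1) by simp
  then have "vec.dim P = 1"
    unfolding v(2) vec.dim_span by (subst vec.dim_eq_card_independent) auto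
  then show "P \<in> pg_points" using v(2) by (simp add: pg_points_def)
qed

lemma dim_annih_singleton:
  fixes c :: "'a::field ^ 'n"
  assumes "c \<noteq> 0"
  shows "vec.dim (annih {c}) + 1 = CARD('n)"
proof -
  have "c \<notin> vec.span {}" using assms by simp
  then obtain v where v: "dot v c = 1" by (rule annih_separates)
  have sub: "vec.span (annih {c}) = annih {c}"
    using subspace_annih vec.span_eq_iff by blast
  then have "v \<notin> vec.span (annih {c})" unfolding sub using v by (simp add: annih_def)
  then have "vec.dim (insert v (annih {c})) = vec.dim (annih {c}) + 1"
    by (simp add: vec.dim_insert)
  moreover have "vec.span (insert v (annih {c})) = UNIV"
  proof -
    have "x - dot x c *s v \<in> annih {c}" for x using v by (simp add: annih_def)
    then show ?thesis unfolding vec.span_insert sub by blast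
  qed
  then have "vec.dim (insert v (annih {c})) = CARD('n)"
    using vec.dim_eq_full by (metis card_cart_basis vec.dimension_def)
  ultimately show ?thesis by simp
qed

text \<open>A subspace of dimension \<open>CARD('n) - 1\<close> is proper, so a nonzero functional
  kills it; its kernel has the same dimension and so coincides with it.\<close>

lemma pg_hyperplanes_iff:
  fixes H :: "('a::field ^ 'n) set"
  shows "H \<in> pg_hyperplanes \<longleftrightarrow> (\<exists>c. c \<noteq> 0 \<and> H = annih {c})"
proof
  assume "H \<in> pg_hyperplanes"
  then have H: "vec.subspace H" "vec.dim H = CARD('n) - 1" by (auto simp: pg_hyperplanes_def)
  have "CARD('n) > 0" by simp
  then have "CARD('n) - 1 \<noteq> CARD('n)" by linarith
  then have "vec.span H \<noteq> UNIV"
    unfolding vec.dim_eq_full[symmetric] H(2) vec.dimension_def card_cart_basis .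
  then obtain v where "v \<notin> vec.span H" by blast
  then obtain c where c: "c \<in> annih H" "dot c v = 1" by (rule annih_separates)
  have "c \<noteq> 0" using c(2) by auto
  moreover have "H = annih {c}"
  proof (rule vec.subspace_dim_equal)
    show "H \<subseteq> annih {c}" using c(1) by (auto simp: annih_def dot_commute)
    show "vec.dim (annih {c}) \<le> vec.dim H"
      using dim_annih_singleton[OF \<open>c \<noteq> 0\<close>] H(2) by simp
  qed (use H(1) subspace_annih in auto)
  ultimately show "\<exists>c. c \<noteq> 0 \<and> H = annih {c}" by blast
next
  assume "\<exists>c. c \<noteq> 0 \<and> H = annih {c}"
  then obtain c where "c \<noteq> 0" "H = annih {c}" by blast
  then show "H \<in> pg_hyperplanes"
    using dim_annih_singleton[of c] subspace_annih[of "{c}"] by (simp add: pg_hyperplanes_def)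
qed

lemma span_singleton_subset_annih: "vec.span {v} \<subseteq> annih {c} \<longleftrightarrow> dot c v = 0"
proof
  assume "vec.span {v} \<subseteq> annih {c}"
  then have "v \<in> annih {c}" using vec.span_base by blast
  then show "dot c v = 0" by (simp add: annih_def dot_commute)
next
  assume "dot c v = 0"
  then show "vec.span {v} \<subseteq> annih {c}"
    by (intro vec.span_minimal subspace_annih) (simp add: annih_def dot_commute)
qed

lemma span_singleton_eq:
  fixes v y :: "'a::{field,finite} ^ 'n"
  assumes "v \<noteq> 0" "v \<in> vec.span {y}"
  shows "vec.span {v} = vec.span {y}"
  using span_singleton_swap(1)[OF assms] assms(2)
  by (intro subset_antisym vec.span_minimal) auto

text \<open>Choosing one spanning vector in each point carries an arc over to the vector setting of
  \<open>near_maximal\<close> with all counts preserved.\<close>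

lemma obtain_representatives:
  fixes K :: "('a::{field,finite} ^ 'n) set set"
  assumes "K \<subseteq> pg_points"
  obtains S where "\<And>v. v \<in> S \<Longrightarrow> v \<noteq> 0" "K = (\<lambda>v. vec.span {v}) ` S" "card S = card K"
    "\<And>c. card (points_on K (annih {c})) = inc S c"
proof -
  have "\<forall>P\<in>K. \<exists>v. v \<noteq> 0 \<and> P = vec.span {v}"
    using assms pg_points_iff by blast
  then obtain rep where rep: "\<And>P. P \<in> K \<Longrightarrow> rep P \<noteq> 0" "\<And>P. P \<in> K \<Longrightarrow> P = vec.span {rep P}"
    by metis
  define S where "S = rep ` K"
  have inj: "inj_on rep K" using rep(2) by (metis inj_onI)
  show thesis
  proof (rule that)
    show "v \<noteq> 0" if "v \<in> S" for v using that rep(1) by (auto simp: S_def)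
    show "K = (\<lambda>v. vec.span {v}) ` S"
      using rep(2) unfolding S_def image_image by (metis (no_types, lifting) image_cong image_ident)
    show "card S = card K" unfolding S_def by (rule card_image[OF inj])
    show "card (points_on K (annih {c})) = inc S c" for c
    proof -
      have "P \<subseteq> annih {c} \<longleftrightarrow> dot c (rep P) = 0" if "P \<in> K" for P
        using rep(2)[OF that] span_singleton_subset_annih by metis
      then have "{v\<in>S. dot c v = 0} = rep ` points_on K (annih {c})"
        by (auto simp: S_def points_on_def)
      moreover have "inj_on rep (points_on K (annih {c}))"
        using inj by (rule inj_on_subset) (auto simp: points_on_def)
      ultimately show ?thesis unfolding inc_def by (simp add: card_image)
    qed
  qed
qed

lemma card_points_on_Un:
  fixes K :: "('a::{field,finite} ^ 'n) set set"
  assumes "X \<notin> K"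
  shows "card (points_on (K \<union> {X}) H) = card (points_on K H) + (if X \<subseteq> H then 1 else 0)"
proof -
  have "points_on (K \<union> {X}) H = (if X \<subseteq> H then insert X (points_on K H) else points_on K H)"
    by (auto simp: points_on_def)
  moreover have "X \<notin> points_on K H" using assms by (simp add: points_on_def)
  ultimately show ?thesis by simp
qed

section \<open>Transfer of the plane results to arcs of projective points\<close>

theorem lemma4:
  fixes K :: "('a::{field,finite} ^ 'n) set set" and q k s n :: nat
  assumes "q = CARD('a)" and "k = CARD('n)"
    and "k \<ge> 3" and "0 < s" and "s + 2 < q" and "(s + 2) dvd q"
    and "arc n (k + s - 1) K"
    and "n = (s + 1) * (q + 1) + k - 3"
  shows "(\<exists>!X. X \<in> pg_points \<and>
             (\<forall>H. tangent (k + s - 1) K H \<longrightarrow> X \<subseteq> H) \<and>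
             (\<forall>H. secant (k + s - 1) K H \<longrightarrow> \<not> X \<subseteq> H)) \<and>
         \<not> complete_arc n (k + s - 1) K \<and>
         (\<exists>!X. X \<in> pg_points \<and> X \<notin> K \<and> arc (n + 1) (k + s - 1) (K \<union> {X})) \<and>
         (\<forall>X. X \<in> pg_points \<and> X \<notin> K \<and> arc (n + 1) (k + s - 1) (K \<union> {X}) \<longrightarrow>
              maximal_arc (n + 1) s (K \<union> {X}))"
proof -
  have K: "K \<subseteq> pg_points" "card K = n" "k + s - 1 < n"
    "\<And>H. H \<in> pg_hyperplanes \<Longrightarrow> card (points_on K H) \<le> k + s - 1"
    using assms(7) by (auto simp: arc_def)
  obtain S where S: "\<And>v. v \<in> S \<Longrightarrow> v \<noteq> 0" "K = (\<lambda>v. vec.span {v}) ` S" "card S = card K"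
    and points: "\<And>c. card (points_on K (annih {c})) = inc S c"
    by (rule obtain_representatives[OF K(1)]) blast
  \<comment> \<open>With \<open>j = k - 3\<close> this makes \<open>k + s - 1 = j + e + 1\<close>
    and \<open>n = e * (q + 1) + j\<close>.\<close>
  define e where "e = s + 1"
  interpret near_maximal S e "k - 3" q
  proof
    show "card S = e * (q + 1) + (k - 3)" using S(3) K(2) assms by (simp add: e_def)
    show "inc S c \<le> k - 3 + e + 1" if "c \<noteq> 0" for c
      using K(4)[of "annih {c}"] points[of c] that pg_hyperplanes_iff assms(3)
      by (force simp: e_def)
  qed (use assms in \<open>auto simp: e_def\<close>)
  have k: "k = 3" using j_eq_0 assms(3) by simp
  have r: "k + s - 1 = e + 1" using k by (simp add: e_def)
  have tangent: "tangent (k + s - 1) K H \<longleftrightarrow> (\<exists>c\<in>tangents. H = annih {c})" for H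
  proof
    assume "tangent (k + s - 1) K H"
    then obtain c where c: "c \<noteq> 0" "H = annih {c}" "0 < inc S c" "inc S c < e + 1"
      unfolding r tangent_def pg_hyperplanes_iff by (auto simp: points)
    from c(1) have "c \<in> tangents"
      by (cases rule: inc_cases) (use c in \<open>auto simp: tangents_def\<close>)
    then show "\<exists>c\<in>tangents. H = annih {c}" using c(2) by blast
  next
    assume "\<exists>c\<in>tangents. H = annih {c}"
    then show "tangent (k + s - 1) K H"
      using e_ge unfolding r tangent_def pg_hyperplanes_iff by (auto simp: points tangents_def)
  qed
  have secant: "secant (k + s - 1) K H \<longleftrightarrow> (\<exists>c. c \<noteq> 0 \<and> inc S c = e + 1 \<and> H = annih {c})" for H
    unfolding r secant_def pg_hyperplanes_iff by (auto simp: points)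
  obtain y where y: "y \<noteq> 0" "tangents = annih {y} - {0}"
    by (rule tangents_pencil)
  define Y where "Y = vec.span {y}"
  have Y: "Y \<in> pg_points" using y(1) by (auto simp: Y_def pg_points_iff)
  have Y_sub: "Y \<subseteq> annih {c} \<longleftrightarrow> dot c y = 0" for c
    by (simp add: Y_def span_singleton_subset_annih)
  \<comment> \<open>Both uniqueness claims rest on this: a point on all tangents is the centre of
    the pencil.\<close>
  have unique: "X = Y" if "X \<in> pg_points" "\<And>c. c \<in> tangents \<Longrightarrow> X \<subseteq> annih {c}" for X
  proof -
    obtain x where x: "x \<noteq> 0" "X = vec.span {x}" using \<open>X \<in> pg_points\<close> pg_points_iff by blast
    have "dot c x = 0" if "c \<in> tangents" for c
      using \<open>c \<in> tangents \<Longrightarrow> X \<subseteq> annih {c}\<close> that by (simp add: x(2) span_singleton_subset_annih)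
    then have "x \<in> vec.span {y}" by (rule tangents_center_unique[OF y(2)])
    then show "X = Y" using span_singleton_eq x Y_def by blast
  qed
  have Y_tangents: "Y \<subseteq> annih {c}" if "c \<in> tangents" for c
    unfolding Y_sub using that y(2) by (simp add: annih_def)
  have Y_iff: "Y \<subseteq> annih {c} \<longleftrightarrow> inc S c = e" if "c \<noteq> 0" for c
  proof -
    have "c \<in> tangents \<longleftrightarrow> dot c y = 0"
      unfolding y(2) using that by (simp add: annih_def)
    then show ?thesis unfolding Y_sub using that by (simp add: tangents_def)
  qed
  have incident: "\<exists>!X. X \<in> pg_points \<and> (\<forall>H. tangent (k + s - 1) K H \<longrightarrow> X \<subseteq> H) \<and>
      (\<forall>H. secant (k + s - 1) K H \<longrightarrow> \<not> X \<subseteq> H)"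
  proof (rule ex1I[of _ Y])
    show "Y \<in> pg_points \<and> (\<forall>H. tangent (k + s - 1) K H \<longrightarrow> Y \<subseteq> H) \<and>
        (\<forall>H. secant (k + s - 1) K H \<longrightarrow> \<not> Y \<subseteq> H)"
      unfolding tangent secant
    proof (intro conjI allI impI)
      show "Y \<subseteq> H" if "\<exists>c\<in>tangents. H = annih {c}" for H
        using that Y_tangents by blast
      show "\<not> Y \<subseteq> H" if "\<exists>c. c \<noteq> 0 \<and> inc S c = e + 1 \<and> H = annih {c}" for H
        using that Y_iff by auto
    qed (rule Y)
  qed (use unique tangent in blast)
  have in_K: "\<exists>v\<in>S. v \<in> vec.span {x}" if "vec.span {x} \<in> K" for x
    using that vec.span_base unfolding S(2) by blast
  have not_in_K: "v \<notin> vec.span {x}" if "vec.span {x} \<notin> K" "v \<in> S" for v x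
    using that span_singleton_eq[of v x] S(1,2) by auto
  \<comment> \<open>A point of \<open>K\<close> lies on a secant, whereas by \<open>Y_iff\<close>
    every hyperplane through \<open>Y\<close> has \<open>e\<close> points.\<close>
  have "Y \<notin> K"
  proof
    assume "Y \<in> K"
    then obtain v where v: "v \<in> S" "v \<in> vec.span {y}" using in_K by (auto simp: Y_def)
    obtain c where c: "c \<noteq> 0" "dot c v = 0" "inc S c = e + 1"
      by (rule exists_secant[OF v(1)])
    have "annih {v} = annih {y}" using span_singleton_swap(2) S(1) v by blast
    then have "dot c y = 0" using c(2) annih_iff_singleton by blast
    then show False using c Y_iff[of c] Y_sub[of c] by simp
  qed
  have "arc (n + 1) (k + s - 1) (K \<union> {Y})"
    unfolding arc_def
  proof (intro conjI ballI)
    show "CARD('n) - 1 \<le> k + s - 1" using assms(2) by simp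
    show "k + s - 1 < n + 1" using K(3) by simp
    show "K \<union> {Y} \<subseteq> pg_points" using K(1) Y by simp
    show "card (K \<union> {Y}) = n + 1" using \<open>Y \<notin> K\<close> K(2) by simp
    \<comment> \<open>Adding \<open>Y\<close> raises only the counts equal to \<open>e\<close>, and
      these become \<open>e + 1\<close>.\<close>
    show "card (points_on (K \<union> {Y}) H) \<le> k + s - 1" if H: "H \<in> pg_hyperplanes" for H
    proof -
      obtain c where c: "c \<noteq> 0" "H = annih {c}"
        using H unfolding pg_hyperplanes_iff by blast
      show ?thesis
        using Y_iff[OF c(1)] K(4)[OF H]
        unfolding card_points_on_Un[OF \<open>Y \<notin> K\<close>] c(2) r points by simp
    qed
    have "tangents \<noteq> {}" using card_tangents q_gt by auto
    then obtain c where c: "c \<in> tangents" by blast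
    then have "card (points_on (K \<union> {Y}) (annih {c})) = k + s - 1"
      using Y_tangents[OF c]
      unfolding card_points_on_Un[OF \<open>Y \<notin> K\<close>] r points by (simp add: tangents_def)
    moreover have "annih {c} \<in> pg_hyperplanes" using c unfolding pg_hyperplanes_iff tangents_def by blast
    ultimately show "\<exists>H\<in>pg_hyperplanes. card (points_on (K \<union> {Y}) H) = k + s - 1" by blast
  qed
  \<comment> \<open>If \<open>X\<close> extends the arc, a line through \<open>X\<close> can hold at
    most \<open>e\<close> points of \<open>K\<close>. By \<open>tangents_eq_annih\<close> the
    tangents are then the lines through \<open>X\<close>.\<close>
  moreover have "X = Y" if X: "X \<in> pg_points" "X \<notin> K" "arc (n + 1) (k + s - 1) (K \<union> {X})" for X
  proof -
    obtain x where x: "x \<noteq> 0" "X = vec.span {x}" using X(1) pg_points_iff by blast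
    have "tangents = annih {x} - {0}"
    proof (rule tangents_eq_annih)
      show "v \<notin> vec.span {x}" if "v \<in> S" for v using not_in_K X(2) x(2) that by simp
      show "inc S c \<le> e" if "c \<noteq> 0" "dot c x = 0" for c
      proof -
        have "X \<subseteq> annih {c}" using that(2) by (simp add: x(2) span_singleton_subset_annih)
        moreover have "annih {c} \<in> pg_hyperplanes"
          using that(1) unfolding pg_hyperplanes_iff by blast
        then have "card (points_on (K \<union> {X}) (annih {c})) \<le> e + 1"
          using X(3) unfolding r arc_def by simp
        ultimately show ?thesis
          unfolding card_points_on_Un[OF X(2)] points by simp
      qed
    qed (rule x(1))
    then have "dot c x = 0" if "c \<in> tangents" for c
      using that by (simp add: annih_def)
    then show "X = Y"
      by (intro unique X(1)) (simp add: x(2) span_singleton_subset_annih)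
  qed
  ultimately have extension:
    "\<exists>!X. X \<in> pg_points \<and> X \<notin> K \<and> arc (n + 1) (k + s - 1) (K \<union> {X})"
    using Y \<open>Y \<notin> K\<close> by blast
  have "\<not> complete_arc n (k + s - 1) K"
    using \<open>arc (n + 1) (k + s - 1) (K \<union> {Y})\<close> unfolding complete_arc_def by blast
  moreover have "maximal_arc (n + 1) s (K \<union> {X})" if "arc (n + 1) (k + s - 1) (K \<union> {X})" for X
    using that assms k by (auto simp: maximal_arc_def)
  ultimately show ?thesis
    by (intro conjI allI impI incident extension) simp_all
qed

end
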